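(* Let $n\ge 1$. The semigroup $\mathcal{IC}_n$ is $\mathcal{J}$-trivial, and likewise the semigroup $\mathcal{Q}'_n$ is $\mathcal{J}$-trivial.
   Context: Let $[n]=\{1,2,\ldots,n\}$ with its usual order. A partial transformation of $[n]$ is a map from a subset $\mathrm{Dom}\,\alpha\subseteq[n]$ into $[n]$ (the empty map is allowed). Maps are written on the right and composed left to right: $x(\alpha\beta)=(x\alpha)\beta$. $\mathcal{IC}_n$ is the monoid, under composition, of all injective partial transformations $\alpha$ of $[n]$ that are isotone ($x\le y$ implies $x\alpha\le y\alpha$ for all $x,y\in\mathrm{Dom}\,\alpha$) and order-decreasing ($x\alpha\le x$ for all $x\in \mathrm{Dom}\,\alpha$). $\mathcal{Q}'_n=\{\alpha\in\mathcal{IC}_n: 1\notin\mathrm{Dom}\,\alpha\}$ is a subsemigroup. $\mathcal{J}$ is the usual Green's relation ($a\,\mathcal{J}\,b$ iff $S^1aS^1=S^1bS^1$); a semigroup is $\mathcal{J}$-trivial if $\mathcal{J}$ is the equality relation on it. *)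

theory Defs
  imports Main
begin

section \<open>Green's relation J on a semigroup given by a carrier and a multiplication\<close>

definition is_semigroup :: "'a set \<Rightarrow> ('a \<Rightarrow> 'a \<Rightarrow> 'a) \<Rightarrow> bool" where
  "is_semigroup S m \<longleftrightarrow>
     (\<forall>a\<in>S. \<forall>b\<in>S. m a b \<in> S) \<and>
     (\<forall>a\<in>S. \<forall>b\<in>S. \<forall>c\<in>S. m (m a b) c = m a (m b c))"

definition has_identity :: "'a set \<Rightarrow> ('a \<Rightarrow> 'a \<Rightarrow> 'a) \<Rightarrow> bool" where
  "has_identity S m \<longleftrightarrow> (\<exists>e\<in>S. \<forall>a\<in>S. m e a = a \<and> m a e = a)"

text \<open>
  The semigroup \<open>S\<^sup>1\<close> lives in the option type: \<open>Some a\<close> is the element \<open>a\<close> of \<open>S\<close>, and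
  \<open>None\<close> is the new identity, which is adjoined only if \<open>S\<close> has no identity element.
\<close>

definition adjoin_one :: "'a set \<Rightarrow> ('a \<Rightarrow> 'a \<Rightarrow> 'a) \<Rightarrow> 'a option set" where
  "adjoin_one S m = (if has_identity S m then Some ` S else insert None (Some ` S))"

fun adjoin_mult :: "('a \<Rightarrow> 'a \<Rightarrow> 'a) \<Rightarrow> 'a option \<Rightarrow> 'a option \<Rightarrow> 'a option" where
  "adjoin_mult m None y = y"
| "adjoin_mult m (Some a) None = Some a"
| "adjoin_mult m (Some a) (Some b) = Some (m a b)"

text \<open>The set \<open>S\<^sup>1 a S\<^sup>1\<close>, as a subset of \<open>S\<^sup>1\<close>.\<close>

definition principal_ideal :: "'a set \<Rightarrow> ('a \<Rightarrow> 'a \<Rightarrow> 'a) \<Rightarrow> 'a \<Rightarrow> 'a option set" where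
  "principal_ideal S m a =
     {adjoin_mult m (adjoin_mult m x (Some a)) y | x y.
        x \<in> adjoin_one S m \<and> y \<in> adjoin_one S m}"

definition green_J :: "'a set \<Rightarrow> ('a \<Rightarrow> 'a \<Rightarrow> 'a) \<Rightarrow> 'a rel" where
  "green_J S m =
     {(a, b). a \<in> S \<and> b \<in> S \<and> principal_ideal S m a = principal_ideal S m b}"

definition J_trivial :: "'a set \<Rightarrow> ('a \<Rightarrow> 'a \<Rightarrow> 'a) \<Rightarrow> bool" where
  "J_trivial S m \<longleftrightarrow> green_J S m = Id_on S"


section \<open>The semigroups of partial transformations\<close>

text \<open>
  A partial transformation of \<open>{1..n}\<close> is a map \<open>\<alpha> :: nat \<rightharpoonup> nat\<close> whose domain and range are
  contained in \<open>{1..n}\<close>; since \<open>\<alpha> x = None\<close> off the domain, equality of such maps is equality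
  of partial transformations.
\<close>

definition partial_transf :: "nat \<Rightarrow> (nat \<rightharpoonup> nat) set" where
  "partial_transf n = {\<alpha>. dom \<alpha> \<subseteq> {1..n} \<and> ran \<alpha> \<subseteq> {1..n}}"

text \<open>Left-to-right composition: first \<open>\<alpha>\<close>, then \<open>\<beta>\<close>.\<close>

definition pcomp :: "(nat \<rightharpoonup> nat) \<Rightarrow> (nat \<rightharpoonup> nat) \<Rightarrow> (nat \<rightharpoonup> nat)" where
  "pcomp \<alpha> \<beta> = \<beta> \<circ>\<^sub>m \<alpha>"

definition isotone :: "(nat \<rightharpoonup> nat) \<Rightarrow> bool" where
  "isotone \<alpha> \<longleftrightarrow> mono_on (dom \<alpha>) (\<lambda>x. the (\<alpha> x))"

definition order_decreasing :: "(nat \<rightharpoonup> nat) \<Rightarrow> bool" where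
  "order_decreasing \<alpha> \<longleftrightarrow> (\<forall>x\<in>dom \<alpha>. the (\<alpha> x) \<le> x)"

definition IC :: "nat \<Rightarrow> (nat \<rightharpoonup> nat) set" where
  "IC n = {\<alpha> \<in> partial_transf n. inj_on \<alpha> (dom \<alpha>) \<and> isotone \<alpha> \<and> order_decreasing \<alpha>}"

definition Q' :: "nat \<Rightarrow> (nat \<rightharpoonup> nat) set" where
  "Q' n = {\<alpha> \<in> IC n. 1 \<notin> dom \<alpha>}"

lemma pcomp_Some_iff: "pcomp \<alpha> \<beta> x = Some z \<longleftrightarrow> (\<exists>y. \<alpha> x = Some y \<and> \<beta> y = Some z)"
  by (simp add: pcomp_def map_comp_Some_iff)

lemma pcomp_assoc: "pcomp (pcomp \<alpha> \<beta>) \<gamma> = pcomp \<alpha> (pcomp \<beta> \<gamma>)"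
  by (rule ext) (simp add: pcomp_def map_comp_def split: option.split)

lemma IC_iff:
  "\<alpha> \<in> IC n \<longleftrightarrow>
     (\<forall>x y. \<alpha> x = Some y \<longrightarrow> x \<in> {1..n} \<and> y \<in> {1..n} \<and> y \<le> x) \<and>
     (\<forall>x x' y. \<alpha> x = Some y \<longrightarrow> \<alpha> x' = Some y \<longrightarrow> x = x') \<and>
     (\<forall>x x' y y'. \<alpha> x = Some y \<longrightarrow> \<alpha> x' = Some y' \<longrightarrow> x \<le> x' \<longrightarrow> y \<le> y')"
proof -
  have t: "\<alpha> \<in> partial_transf n \<and> order_decreasing \<alpha> \<longleftrightarrow>
      (\<forall>x y. \<alpha> x = Some y \<longrightarrow> x \<in> {1..n} \<and> y \<in> {1..n} \<and> y \<le> x)"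
    unfolding partial_transf_def order_decreasing_def subset_eq Ball_def dom_def ran_def
      mem_Collect_eq
    by (metis not_None_eq option.sel)
  have i: "inj_on \<alpha> (dom \<alpha>) \<longleftrightarrow>
      (\<forall>x x' y. \<alpha> x = Some y \<longrightarrow> \<alpha> x' = Some y \<longrightarrow> x = x')"
    unfolding inj_on_def Ball_def dom_def mem_Collect_eq by (metis not_None_eq)
  have m: "isotone \<alpha> \<longleftrightarrow>
      (\<forall>x x' y y'. \<alpha> x = Some y \<longrightarrow> \<alpha> x' = Some y' \<longrightarrow> x \<le> x' \<longrightarrow> y \<le> y')"
    unfolding isotone_def mono_on_def dom_def mem_Collect_eq
    by (metis not_None_eq option.sel)
  show ?thesis
    unfolding IC_def mem_Collect_eq using t i m by blast
qed

lemma pcomp_IC: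
  assumes "\<alpha> \<in> IC n" "\<beta> \<in> IC n"
  shows "pcomp \<alpha> \<beta> \<in> IC n"
proof -
  have a: "\<alpha> x = Some y \<Longrightarrow> x \<in> {1..n} \<and> y \<le> x" for x y
    using assms(1) unfolding IC_iff by blast
  have b: "\<beta> x = Some y \<Longrightarrow> y \<in> {1..n} \<and> y \<le> x" for x y
    using assms(2) unfolding IC_iff by blast
  have ai: "\<alpha> x = Some y \<Longrightarrow> \<alpha> x' = Some y \<Longrightarrow> x = x'"
    and am: "\<alpha> x = Some y \<Longrightarrow> \<alpha> x' = Some y' \<Longrightarrow> x \<le> x' \<Longrightarrow> y \<le> y'" for x x' y y'
    using assms(1) unfolding IC_iff by blast+
  have bi: "\<beta> x = Some y \<Longrightarrow> \<beta> x' = Some y \<Longrightarrow> x = x'"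
    and bm: "\<beta> x = Some y \<Longrightarrow> \<beta> x' = Some y' \<Longrightarrow> x \<le> x' \<Longrightarrow> y \<le> y'" for x x' y y'
    using assms(2) unfolding IC_iff by blast+
  have "x \<in> {1..n} \<and> z \<in> {1..n} \<and> z \<le> x" if "pcomp \<alpha> \<beta> x = Some z" for x z
    using that a b unfolding pcomp_Some_iff by (meson le_trans)
  moreover have "x = x'" if "pcomp \<alpha> \<beta> x = Some z" "pcomp \<alpha> \<beta> x' = Some z" for x x' z
    using that ai bi unfolding pcomp_Some_iff by blast
  moreover have "z \<le> z'"
    if "pcomp \<alpha> \<beta> x = Some z" "pcomp \<alpha> \<beta> x' = Some z'" "x \<le> x'" for x x' z z'
    using that am bm unfolding pcomp_Some_iff by blast
  ultimately show ?thesis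
    unfolding IC_iff by blast
qed

lemma is_semigroup_IC: "is_semigroup (IC n) pcomp"
  by (simp add: is_semigroup_def pcomp_IC pcomp_assoc)

lemma has_identity_IC: "has_identity (IC n) pcomp"
proof -
  let ?e = "\<lambda>x. if x \<in> {1..n} then Some x else None"
  have "?e \<in> IC n"
    by (auto simp: IC_iff split: if_splits)
  moreover have "pcomp ?e \<alpha> = \<alpha> \<and> pcomp \<alpha> ?e = \<alpha>" if "\<alpha> \<in> IC n" for \<alpha>
  proof -
    have r: "\<alpha> x = Some y \<Longrightarrow> x \<in> {1..n} \<and> y \<in> {1..n}" for x y
      using that unfolding IC_iff by blast
    have "pcomp ?e \<alpha> x = \<alpha> x \<and> pcomp \<alpha> ?e x = \<alpha> x" for x
      using r[of x] by (cases "\<alpha> x") (auto simp: pcomp_def map_comp_def)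
    then show ?thesis
      by (simp add: fun_eq_iff)
  qed
  ultimately show ?thesis
    unfolding has_identity_def by blast
qed

lemma is_semigroup_Q': "is_semigroup (Q' n) pcomp"
proof -
  have "pcomp \<alpha> \<beta> \<in> Q' n" if "\<alpha> \<in> Q' n" "\<beta> \<in> Q' n" for \<alpha> \<beta>
    using that pcomp_IC[of \<alpha> n \<beta>] by (simp add: Q'_def domIff pcomp_def)
  then show ?thesis
    by (simp add: is_semigroup_def pcomp_assoc)
qed

end

(* If a = x b y and b = u a v with x, y, u, v injective and order-decreasing, then x maps dom a
   into dom b and u maps dom b into dom a, so xu is an injective order-decreasing map of dom a
   into itself and hence the identity.  As i x u \<le> i x \<le> i, already x fixes dom a pointwise,
   and symmetrically u fixes dom b.  So the domains agree, and order-decreasingness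
   of y and v gives i a \<le> i b and i b \<le> i a. *)
theory Submission
  imports Defs
begin

text \<open>Strong induction: if \<open>f i < i\<close>, then \<open>f i\<close> lies in
  \<open>A\<close> and is already fixed, so \<open>f i\<close> and \<open>i\<close> have the same
  image, against injectivity.\<close>

lemma inj_decreasing_self_map_fixes:
  fixes f :: "'a::wellorder \<Rightarrow> 'a"
  assumes "inj_on f A" "f ` A \<subseteq> A" "\<And>i. i \<in> A \<Longrightarrow> f i \<le> i" "i \<in> A"
  shows "f i = i"
  using \<open>i \<in> A\<close>
proof (induction i rule: less_induct)
  case (less i)
  show ?case
  proof (rule ccontr)
    assume "f i \<noteq> i"
    then have "f i < i" using assms(3) less.prems by (simp add: order_less_le)
    then have "f (f i) = f i" using less assms(2) by blast
    then show False
      using \<open>f i \<noteq> i\<close> assms(1,2) less.prems by (meson image_subset_iff inj_onD)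
  qed
qed

text \<open>Multiply by an identity on both sides. The cases follow \<open>adjoin_one\<close>:
  \<open>None\<close> is available only when \<open>S\<close> has no identity of its own.\<close>

lemma mem_principal_ideal_self:
  assumes "a \<in> S"
  shows "Some a \<in> principal_ideal S m a"
proof (cases "has_identity S m")
  case True
  then obtain e where "e \<in> S" "m (m e a) e = a"
    using assms unfolding has_identity_def by metis
  then show ?thesis
    using True unfolding principal_ideal_def adjoin_one_def
    by (intro CollectI exI[of _ "Some e"]) simp
next
  case False
  then show ?thesis
    unfolding principal_ideal_def adjoin_one_def
    by (intro CollectI exI[of _ None]) simp
qed

text \<open>Wide enough to cover \<open>IC n\<close>, \<open>Q' n\<close> and also the total map
  \<open>Some\<close>, which lies in no \<open>partial_transf n\<close>.\<close>

definition decreasing_injection :: "(nat \<rightharpoonup> nat) \<Rightarrow> bool" where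
  "decreasing_injection \<alpha> \<longleftrightarrow> inj_on \<alpha> (dom \<alpha>) \<and> order_decreasing \<alpha>"

lemma decreasing_injection_inj:
  "decreasing_injection \<alpha> \<Longrightarrow> \<alpha> i = Some k \<Longrightarrow> \<alpha> j = Some k \<Longrightarrow> i = j"
  unfolding decreasing_injection_def inj_on_def dom_def by simp

lemma decreasing_injection_le: "decreasing_injection \<alpha> \<Longrightarrow> \<alpha> i = Some k \<Longrightarrow> k \<le> i"
  unfolding decreasing_injection_def order_decreasing_def dom_def by force

lemma decreasing_injection_Some: "decreasing_injection Some"
  by (simp add: decreasing_injection_def order_decreasing_def)

lemma principal_ideal_factorization:
  assumes "Some a \<in> principal_ideal S pcomp b" "\<And>s. s \<in> S \<Longrightarrow> decreasing_injection s"
  obtains x y where "decreasing_injection x" "decreasing_injection y"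
    "a = pcomp (pcomp x b) y"
proof -
  obtain x y where xy: "x \<in> adjoin_one S pcomp" "y \<in> adjoin_one S pcomp"
    "Some a = adjoin_mult pcomp (adjoin_mult pcomp x (Some b)) y"
    using assms(1) unfolding principal_ideal_def by blast
  \<comment> \<open>The total map \<open>Some\<close> is the identity for \<open>pcomp\<close>, so it can stand for an adjoined identity.\<close>
  let ?act = "\<lambda>x. case x of None \<Rightarrow> Some | Some \<alpha> \<Rightarrow> \<alpha>"
  have "decreasing_injection (?act z)" if "z \<in> adjoin_one S pcomp" for z
    using that assms(2) decreasing_injection_Some
    by (auto simp: adjoin_one_def split: if_splits)
  moreover have "a = pcomp (pcomp (?act x) b) (?act y)"
    using xy(3) by (cases x; cases y) (auto simp: pcomp_def map_comp_def split: option.splits)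
  ultimately show thesis using that xy(1,2) by blast
qed

text \<open>Here \<open>f\<close> is the left factor of \<open>a\<close>, read as a total function;
  the right factor can only lower values, whence \<open>z \<le> w\<close>.\<close>

lemma principal_ideal_map:
  assumes "Some a \<in> principal_ideal S pcomp b" "\<And>s. s \<in> S \<Longrightarrow> decreasing_injection s"
  obtains f where "inj_on f (dom a)" "\<And>i. i \<in> dom a \<Longrightarrow> f i \<le> i"
    "\<And>i z. a i = Some z \<Longrightarrow> \<exists>w. b (f i) = Some w \<and> z \<le> w"
proof -
  obtain x y where x: "decreasing_injection x" and y: "decreasing_injection y"
    and a: "a = pcomp (pcomp x b) y"
    using principal_ideal_factorization assms by blast
  \<comment> \<open>Where \<open>x\<close> is undefined this value is arbitrary, but
    \<open>x\<close> is defined on all of \<open>dom a\<close> because \<open>a\<close> factors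
    through it.\<close>
  let ?f = "\<lambda>i. the (x i)"
  have xf: "x i = Some (?f i)" if "i \<in> dom a" for i
    using that unfolding a by (auto simp: pcomp_Some_iff)
  show thesis
  proof
    show "inj_on ?f (dom a)"
      by (rule inj_onI) (metis xf x decreasing_injection_inj)
    show "?f i \<le> i" if "i \<in> dom a" for i
      using xf[OF that] decreasing_injection_le x by blast
    show "\<exists>w. b (?f i) = Some w \<and> z \<le> w" if "a i = Some z" for i z
      using that decreasing_injection_le[OF y] unfolding a by (auto simp: pcomp_Some_iff)
  qed
qed

lemma mutual_principal_ideals_le:
  assumes "Some a \<in> principal_ideal S pcomp b" "Some b \<in> principal_ideal S pcomp a"
    and "\<And>s. s \<in> S \<Longrightarrow> decreasing_injection s" "a i = Some z"
  shows "\<exists>w. b i = Some w \<and> z \<le> w"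
proof -
  obtain f where f: "inj_on f (dom a)" "\<And>i. i \<in> dom a \<Longrightarrow> f i \<le> i"
    "\<And>i z. a i = Some z \<Longrightarrow> \<exists>w. b (f i) = Some w \<and> z \<le> w"
    using principal_ideal_map[OF assms(1,3)] by blast
  obtain g where g: "inj_on g (dom b)" "\<And>i. i \<in> dom b \<Longrightarrow> g i \<le> i"
    "\<And>i z. b i = Some z \<Longrightarrow> \<exists>w. a (g i) = Some w \<and> z \<le> w"
    using principal_ideal_map[OF assms(2,3)] by blast
  have fb: "f ` dom a \<subseteq> dom b" and ga: "g ` dom b \<subseteq> dom a"
    using f(3) g(3) by fast+
  have i: "i \<in> dom a" using assms(4) by blast
  have "(g \<circ> f) i = i"
  proof (rule inj_decreasing_self_map_fixes)
    show "inj_on (g \<circ> f) (dom a)"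
      using f(1) g(1) fb by (meson comp_inj_on inj_on_subset)
    show "(g \<circ> f) ` dom a \<subseteq> dom a" using fb ga by (auto simp: image_subset_iff)
    show "(g \<circ> f) j \<le> j" if "j \<in> dom a" for j
    proof -
      have "g (f j) \<le> f j" using g(2) fb that by blast
      then show ?thesis using f(2)[OF that] by simp
    qed
  qed (fact i)
  moreover have "g (f i) \<le> f i" using g(2) fb i by blast
  \<comment> \<open>Squeeze: \<open>i = g (f i) \<le> f i \<le> i\<close>.\<close>
  ultimately have "f i = i" using f(2)[OF i] by simp
  then show ?thesis using f(3)[OF assms(4)] by simp
qed

lemma J_trivial_decreasing_injections:
  assumes "\<And>s. s \<in> S \<Longrightarrow> decreasing_injection s"
  shows "J_trivial S pcomp"
proof -
  have "a = b" if "a \<in> S" "b \<in> S" "principal_ideal S pcomp a = principal_ideal S pcomp b" for a b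
  proof -
    have ab: "Some a \<in> principal_ideal S pcomp b" "Some b \<in> principal_ideal S pcomp a"
      using that mem_principal_ideal_self by metis+
    note le = mutual_principal_ideals_le[OF ab assms] mutual_principal_ideals_le[OF ab(2,1) assms]
    show "a = b"
    proof (rule ext)
      show "a i = b i" for i
        \<comment> \<open>Each half of \<open>le\<close> also transfers definedness, so the mixed
          cases are impossible; if both values exist, antisymmetry equates them.\<close>
        using le[of i] by (cases "a i"; cases "b i") auto
    qed
  qed
  then show ?thesis
    unfolding J_trivial_def green_J_def Id_on_def by auto
qed

theorem theorem2p1:
  fixes n :: nat
  assumes "n \<ge> 1"
  shows "J_trivial (IC n) pcomp \<and> J_trivial (Q' n) pcomp"
  by (auto intro!: J_trivial_decreasing_injections
      simp: Q'_def IC_def decreasing_injection_def)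

end
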